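(* Let $\omega$ be a weight. Then the implications $(1)\Rightarrow(2)\Rightarrow(3)\Rightarrow(4)$ hold for the following statements. (1) ($\omega\in A_\infty^{\lambda}$) There exist $0<\beta<1$ and $C>1$ such that for all $n\in\mathbb{N}$ and $\lambda>1$, $\mathbb{E}_\omega(\chi_{\{\frac{\omega}{\omega_n}>\lambda\}}|\mathcal{F}_n)\le C\lambda\,\mathbb{E}(\chi_{\{\frac{\omega}{\omega_n}>\beta\lambda\}}|\mathcal{F}_n)$. (2) ($\omega\in\bigcup_{q>1}RH_q$) There exist $C,q>1$ such that for all $n\in\mathbb{N}$, $\mathbb{E}(\omega^q|\mathcal{F}_n)\le C\,\mathbb{E}(\omega|\mathcal{F}_n)^q$. (3) ($\omega\in A_\infty^{log}$) There exists $C>1$ such that for all $n\in\mathbb{N}$, $\mathbb{E}_\omega(\log^+\frac{\omega}{\omega_n}|\mathcal{F}_n)\le C$. (4) ($\omega\in A_\infty^{M}$) There exist $0<\alpha,\beta<1$ such that for all $n\in\mathbb{N}$ and $A\in\mathcal{F}$: $\mathbb{E}(\chi_A|\mathcal{F}_n)\le\alpha<1\Rightarrow\mathbb{E}_\omega(\chi_A|\mathcal{F}_n)\le\beta<1$.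
   Context: $(\Omega,\mathcal{F},\mu)$ is a complete probability space and $(\mathcal{F}_n)_{n\ge0}$ is an increasing sequence of sub-$\sigma$-fields of $\mathcal{F}$ with $\mathcal{F}=\bigvee_{n\ge0}\mathcal{F}_n$. $\mathbb{N}$ is the set of non-negative integers. $\mathbb{E}(\cdot|\mathcal{F}_n)$ is conditional expectation with respect to $\mu$ (of nonnegative functions it may take the value $+\infty$). Relations between random variables hold almost surely. A weight $\omega$ is a random variable with $\omega>0$ and $\mathbb{E}(\omega)<\infty$; $\omega_n:=\mathbb{E}(\omega|\mathcal{F}_n)$. $\mathbb{E}_\omega(\cdot|\mathcal{F}_n)$ is the conditional expectation with respect to $\omega\,d\mu$, i.e. $\mathbb{E}_\omega(f|\mathcal{F}_n)=\mathbb{E}(f\omega|\mathcal{F}_n)/\omega_n$. $\chi_A$ is the indicator function of $A$, and $\log^+x=\max(\log x,0)$. *)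

theory Defs
  imports "HOL-Probability.Probability"
begin

locale complete_filtered_prob_space =
  prob_space M + complete_measure M + filtration "space M" F
  for M :: "'a measure" and F :: "nat \<Rightarrow> 'a measure" +
  assumes sets_F_subset: "\<And>n. sets (F n) \<subseteq> sets M"
    and sets_generated: "sets M = sigma_sets (space M) (\<Union>n. sets (F n))"

definition weight :: "'a measure \<Rightarrow> ('a \<Rightarrow> real) \<Rightarrow> bool" where
  "weight M w \<longleftrightarrow> integrable M w \<and> (AE x in M. w x > 0)"

text \<open>Conditional expectation with respect to the (finite, not normalised) measure
  \<open>w d\<mu>\<close>. The lemma \<open>weighted_cond_exp_eq\<close> below identifies it with the quotient
  \<open>E(f w | G) / E(w | G)\<close>.\<close>

definition weighted_cond_exp ::
    "'a measure \<Rightarrow> ('a \<Rightarrow> real) \<Rightarrow> 'a measure \<Rightarrow> ('a \<Rightarrow> ennreal) \<Rightarrow> 'a \<Rightarrow> ennreal" where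
  "weighted_cond_exp M w G f = nn_cond_exp (density M (\<lambda>x. ennreal (w x))) G f"

lemma weighted_cond_exp_eq:
  assumes M: "prob_space M" and G: "subalgebra M G" and w: "weight M w"
    and f [measurable]: "f \<in> borel_measurable M"
  shows "AE x in M. weighted_cond_exp M w G f x =
    nn_cond_exp M G (\<lambda>x. f x * ennreal (w x)) x / nn_cond_exp M G (\<lambda>x. ennreal (w x)) x"
proof -
  interpret prob_space M by fact
  interpret S: finite_measure_subalgebra M G
    by unfold_locales (rule G)
  have wi: "integrable M w" and pos: "AE x in M. w x > 0"
    using w by (auto simp: weight_def)
  have wm [measurable]: "w \<in> borel_measurable M" using wi by auto
  let ?w = "\<lambda>x. ennreal (w x)"
  let ?N = "density M ?w"
  have fin: "(\<integral>\<^sup>+x. ?w x \<partial>M) < \<infinity>"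
    using wi pos by (subst nn_integral_eq_integral) (auto elim: AE_mp)
  have finN: "finite_measure ?N"
    by (rule finite_measureI)
      (use fin in \<open>simp add: emeasure_density nn_integral_set_ennreal cong: nn_integral_cong\<close>)
  have GN: "subalgebra ?N G" using G by (simp add: subalgebra_def)
  interpret N: finite_measure ?N by (rule finN)
  interpret T: finite_measure_subalgebra ?N G
    by unfold_locales (rule GN)
  let ?e = "nn_cond_exp ?N G f"
  have em [measurable]: "?e \<in> borel_measurable G" by simp
  have em2 [measurable]: "?e \<in> borel_measurable M"
    using measurable_from_subalg[OF G em] .
  have "AE x in M. ?e x * nn_cond_exp M G ?w x = nn_cond_exp M G (\<lambda>x. ?e x * ?w x) x"
    by (rule S.nn_cond_exp_prod) auto
  moreover have "AE x in M. nn_cond_exp M G (\<lambda>x. ?e x * ?w x) x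
      = nn_cond_exp M G (\<lambda>x. f x * ?w x) x"
  proof (rule S.nn_cond_exp_charact)
    fix A assume A: "A \<in> sets G"
    then have AM [measurable]: "A \<in> sets M" using G by (auto simp: subalgebra_def)
    have "(\<integral>\<^sup>+x. indicator A x * ?e x \<partial>?N) = (\<integral>\<^sup>+x. indicator A x * f x \<partial>?N)"
      using A by (intro T.nn_cond_exp_intg) auto
    then have eq: "(\<integral>\<^sup>+x\<in>A. (f x * ?w x) \<partial>M) = (\<integral>\<^sup>+x\<in>A. (?e x * ?w x) \<partial>M)"
      by (simp add: nn_integral_density ac_simps)
    have "(\<integral>\<^sup>+x. indicator A x * nn_cond_exp M G (\<lambda>x. ?e x * ?w x) x \<partial>M)
        = (\<integral>\<^sup>+x. indicator A x * (?e x * ?w x) \<partial>M)"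
      using A by (intro S.nn_cond_exp_intg) auto
    with eq show "(\<integral>\<^sup>+x\<in>A. (f x * ?w x) \<partial>M)
        = (\<integral>\<^sup>+x\<in>A. nn_cond_exp M G (\<lambda>x. ?e x * ?w x) x \<partial>M)"
      by (simp add: ac_simps)
  qed auto
  moreover have "AE x in M. nn_cond_exp M G ?w x \<noteq> \<infinity>"
  proof (rule nn_integral_noteq_infinite)
    have "(\<integral>\<^sup>+x. 1 * nn_cond_exp M G ?w x \<partial>M) = (\<integral>\<^sup>+x. 1 * ?w x \<partial>M)"
      by (rule S.nn_cond_exp_intg) auto
    then show "(\<integral>\<^sup>+x. nn_cond_exp M G ?w x \<partial>M) \<noteq> \<infinity>" using fin by simp
  qed simp
  moreover have "AE x in M. nn_cond_exp M G ?w x \<noteq> 0"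
  proof -
    define Z where "Z = {x \<in> space G. nn_cond_exp M G ?w x = 0}"
    have ZG: "Z \<in> sets G" unfolding Z_def by measurable
    then have ZM [measurable]: "Z \<in> sets M" using G by (auto simp: subalgebra_def)
    have "(\<integral>\<^sup>+x. indicator Z x * ?w x \<partial>M) = (\<integral>\<^sup>+x. indicator Z x * nn_cond_exp M G ?w x \<partial>M)"
      using ZG by (intro S.nn_cond_exp_intg[symmetric]) auto
    also have "\<dots> = (\<integral>\<^sup>+x. 0 \<partial>M)"
      by (rule nn_integral_cong) (auto simp: Z_def indicator_def)
    finally have "AE x in M. indicator Z x * ?w x = 0"
      by (simp add: nn_integral_0_iff_AE)
    with pos have "AE x in M. x \<notin> Z"
      by eventually_elim (auto simp: indicator_def split: if_splits)
    then show ?thesis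
      using AE_space by eventually_elim (use G in \<open>auto simp: Z_def subalgebra_def\<close>)
  qed
  ultimately show ?thesis
    unfolding weighted_cond_exp_def
    by eventually_elim (metis ennreal_mult_divide_eq infinity_ennreal_def)
qed

definition A_infty_lambda :: "'a measure \<Rightarrow> (nat \<Rightarrow> 'a measure) \<Rightarrow> ('a \<Rightarrow> real) \<Rightarrow> bool" where
  "A_infty_lambda M F w \<longleftrightarrow>
    (\<exists>\<beta> C :: real. 0 < \<beta> \<and> \<beta> < 1 \<and> C > 1 \<and>
      (\<forall>n. \<forall>l > 1. AE x in M.
        weighted_cond_exp M w (F n)
            (indicator {y \<in> space M. w y / real_cond_exp M (F n) w y > l}) x
          \<le> ennreal (C * l) *
            nn_cond_exp M (F n)
              (indicator {y \<in> space M. w y / real_cond_exp M (F n) w y > \<beta> * l}) x))"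

definition RH :: "'a measure \<Rightarrow> (nat \<Rightarrow> 'a measure) \<Rightarrow> real \<Rightarrow> ('a \<Rightarrow> real) \<Rightarrow> bool" where
  "RH M F q w \<longleftrightarrow>
    (\<exists>C > 1. \<forall>n. AE x in M.
      nn_cond_exp M (F n) (\<lambda>y. ennreal (w y powr q)) x
        \<le> ennreal (C * real_cond_exp M (F n) w x powr q))"

definition A_infty_log :: "'a measure \<Rightarrow> (nat \<Rightarrow> 'a measure) \<Rightarrow> ('a \<Rightarrow> real) \<Rightarrow> bool" where
  "A_infty_log M F w \<longleftrightarrow>
    (\<exists>C > 1. \<forall>n. AE x in M.
      weighted_cond_exp M w (F n)
          (\<lambda>y. ennreal (max (ln (w y / real_cond_exp M (F n) w y)) 0)) x
        \<le> ennreal C)"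

text \<open>Both sides of the implication are almost sure relations between random variables.
  Replacing \<open>A\<close> by its intersection with the \<open>F n\<close>-measurable set where the first
  relation holds shows that this is the same as requiring the implication pointwise almost surely.\<close>

definition A_infty_M :: "'a measure \<Rightarrow> (nat \<Rightarrow> 'a measure) \<Rightarrow> ('a \<Rightarrow> real) \<Rightarrow> bool" where
  "A_infty_M M F w \<longleftrightarrow>
    (\<exists>\<alpha> \<beta> :: real. 0 < \<alpha> \<and> \<alpha> < 1 \<and> 0 < \<beta> \<and> \<beta> < 1 \<and>
      (\<forall>n. \<forall>A \<in> sets M.
        (AE x in M. nn_cond_exp M (F n) (indicator A) x \<le> ennreal \<alpha>) \<longrightarrow>
        (AE x in M. weighted_cond_exp M w (F n) (indicator A) x \<le> ennreal \<beta>)))"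

end

theory Submission
  imports Defs
begin

text \<open>
  Fix one of the sub-\<open>\<sigma>\<close>-algebras \<open>G\<close> and put \<open>v = w / E(w | G)\<close>. Then \<open>E(v | G) = 1\<close> and the
  weighted conditional expectation of \<open>f\<close> is \<open>E(f v | G)\<close>, so that all four conditions become
  statements about the single positive function \<open>v\<close>. They are treated for one \<open>G\<close> at a time, with
  constants that depend only on the constants in the hypothesis and hence not on \<open>n\<close>.

  The step from the tail condition to the reverse Hoelder inequality is a self-improvement argument
  of Gehring type. Integrating the tail condition over a set \<open>A\<close> of \<open>G\<close> turns it into
  \<open>\<integral>\<^sub>A v \<chi>{v > l} \<le> C l \<mu>(A \<inter> {v > \<beta> l})\<close> for \<open>l > 1\<close>, an unconditional hypothesis on the finite measure
  \<open>\<mu>\<close> restricted to \<open>A\<close>. Let \<open>r = 1 / \<beta>\<close> and \<open>p = r\<^sup>\<epsilon>\<close>. The power \<open>v\<^sup>\<epsilon>\<close> is at most \<open>p\<close>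
  times the step function of \<open>v\<close> that is \<open>p\<^sup>k\<close> on \<open>{r\<^sup>k < v \<le> r\<^sup>k\<^sup>+\<^sup>1}\<close> and \<open>1\<close> on \<open>{v \<le> 1}\<close>. Truncating the
  step function at height \<open>p\<^sup>N\<close> keeps \<open>X = \<integral>\<^sub>A v staircase(v)\<close> finite. Applying the tail condition at
  \<open>l = r\<^sup>k\<^sup>+\<^sup>1\<close> to every step, and summing a geometric series, bounds the contribution of the steps by
  \<open>O(p - 1) X\<close>. If \<open>p\<close> is close enough to \<open>1\<close> this is at most \<open>X / 2\<close>, and \<open>X \<le> 2 \<integral>\<^sub>A v = 2 \<mu>(A)\<close>
  follows. Letting \<open>N\<close> tend to infinity gives \<open>\<integral>\<^sub>A v\<^sup>1\<^sup>+\<^sup>\<epsilon> \<le> 2 p \<mu>(A)\<close> for every \<open>A\<close> in \<open>G\<close>, which is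
  the reverse Hoelder inequality (\<open>higher_integrability_from_tails\<close>,
  \<open>tails_imp_reverse_Hoelder\<close>).

  The other two steps are pointwise estimates inside a conditional expectation. The first uses
  \<open>v log\<^sup>+ v \<le> v\<^sup>q / (q - 1)\<close> (\<open>reverse_Hoelder_imp_log\<close>). The second splits \<open>A\<close> at the level
  \<open>v = e\<^sup>4\<^sup>C\<close>: below it \<open>v\<close> is bounded, above it \<open>v \<le> v log\<^sup>+ v / (4 C)\<close>
  (\<open>log_imp_small_sets\<close>).
\<close>

section \<open>A step function dominating a small power\<close>

text \<open>
  On \<open>r ^ k < t \<le> r ^ Suc k\<close> with \<open>k \<le> N\<close> this is \<open>p ^ k\<close>; it is constant below \<open>r\<close> and beyond \<open>r ^ N\<close>. It is
  written as a sum of jumps at the levels \<open>r ^ Suc k\<close> because the tail hypothesis speaks about the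
  sets where one such level is exceeded; all these levels are above \<open>1\<close>, as the hypothesis requires.
\<close>

definition staircase :: "real \<Rightarrow> real \<Rightarrow> nat \<Rightarrow> real \<Rightarrow> real" where
  "staircase p r N t = 1 + (\<Sum>k<N. (p ^ Suc k - p ^ k) * of_bool (r ^ Suc k < t))"

lemma staircase_ge_1: "1 < p \<Longrightarrow> 1 \<le> staircase p r N t"
  unfolding staircase_def by (auto intro!: sum_nonneg)

lemma staircase_mono: "1 < p \<Longrightarrow> m \<le> n \<Longrightarrow> staircase p r m t \<le> staircase p r n t"
  unfolding staircase_def by (auto intro!: sum_mono2)

lemma staircase_top:
  assumes "1 < r" and "r ^ N < t"
  shows "staircase p r N t = p ^ N"
proof -
  have "r ^ Suc k < t" if "k < N" for k
    using assms that by (meson Suc_leI less_imp_le order_le_less_trans power_increasing)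
  then have "staircase p r N t = 1 + (\<Sum>k<N. p ^ Suc k - p ^ k)"
    unfolding staircase_def by (intro arg_cong2[where f = plus] sum.cong) auto
  also have "\<dots> = p ^ N"
    by (subst sum_lessThan_telescope) simp
  finally show ?thesis .
qed

lemma staircase_le: "1 < p \<Longrightarrow> staircase p r N t \<le> p ^ N"
proof -
  assume "1 < p"
  then have "(\<Sum>k<N. (p ^ Suc k - p ^ k) * of_bool (r ^ Suc k < t)) \<le> (\<Sum>k<N. p ^ Suc k - p ^ k)"
    by (intro sum_mono) (auto simp: of_bool_def)
  also have "\<dots> = p ^ N - 1"
    by (subst sum_lessThan_telescope) simp
  finally show ?thesis by (simp add: staircase_def)
qed

lemma staircase_measurable [measurable]: "staircase p r N \<in> borel_measurable borel"
  unfolding staircase_def of_bool_def by measurable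

text \<open>
  Between two consecutive levels a power of exponent \<open>e\<close> grows only by the factor \<open>r powr e = p\<close>, so
  the step function loses no more than \<open>p\<close>, as soon as the truncation level exceeds \<open>t\<close>.
\<close>

lemma powr_le_staircase:
  assumes p: "1 < p" and r: "1 < r" and e: "r powr e = p" and t: "0 < t"
  shows "\<exists>N. t powr e \<le> p * staircase p r N t"
proof -
  have "0 < e"
  proof (rule ccontr)
    assume "\<not> 0 < e"
    then have "r powr e \<le> r powr 0" using r by (intro powr_mono) auto
    then show False using p r e by simp
  qed
  obtain n where n: "t \<le> r ^ n"
    using real_arch_pow[OF r, of t] by (meson less_imp_le)
  define m where "m = (LEAST n. t \<le> r ^ n)"
  have m: "t \<le> r ^ m"
    unfolding m_def using n by (rule LeastI)
  have "t powr e \<le> (r ^ m) powr e"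
    using m t \<open>0 < e\<close> by (intro powr_mono2) auto
  also have "(r ^ m) powr e = p ^ m"
    using r by (simp flip: e add: powr_powr powr_realpow[symmetric] mult.commute)
  finally have le: "t powr e \<le> p ^ m" .
  show ?thesis
  proof (cases m)
    case 0
    have "1 * 1 \<le> p * staircase p r 0 t"
      using p staircase_ge_1[OF p, of r 0 t] by (intro mult_mono) auto
    then show ?thesis using le 0 by (intro exI[of _ 0]) simp
  next
    case (Suc k)
    have "\<not> t \<le> r ^ k"
      using not_less_Least[of k "\<lambda>n. t \<le> r ^ n"] Suc unfolding m_def[symmetric] by simp
    then show ?thesis
      using le Suc staircase_top[OF r, of k t p] by (intro exI[of _ k]) simp
  qed
qed

text \<open>
  Applying the tail hypothesis to every step produces the sum on the left. It is geometric, hence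
  dominated by its last nonzero term \<open>(p * r) ^ Suc k\<close>, where \<open>r ^ k < t\<close> and \<open>p ^ k\<close> is the height of
  the step function at \<open>t\<close>. This is what brings the integrand \<open>t * staircase p r N t\<close> back.
\<close>

lemma levels_le_staircase:
  assumes p: "1 < p" and r: "1 < r" and t: "0 \<le> t"
  shows "(\<Sum>k\<le>N. (p * r) ^ Suc k * of_bool (r ^ k < t))
    \<le> (p * r)\<^sup>2 / (p * r - 1) * (t * staircase p r N t)"
proof (induction N)
  have s: "1 < p * r" using p r by (simp add: less_1_mult)
  \<comment> \<open>When the top level is exceeded, all terms are present; otherwise neither side sees the last step.\<close>
  have top: "(\<Sum>k\<le>N. (p * r) ^ Suc k * of_bool (r ^ k < t))
    \<le> (p * r)\<^sup>2 / (p * r - 1) * (t * staircase p r N t)" if N: "r ^ N < t" for N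
  proof -
    define s where "s = p * r"
    have s1: "1 < s" using s s_def by simp
    have "(\<Sum>k\<le>N. s ^ Suc k * of_bool (r ^ k < t)) \<le> (\<Sum>k\<le>N. s ^ Suc k)"
      using s1 by (intro sum_mono) (auto simp: of_bool_def)
    also have "\<dots> = s * (\<Sum>k<Suc N. s ^ k)"
      by (simp add: sum_distrib_left lessThan_Suc_atMost del: sum.lessThan_Suc)
    also have "(\<Sum>k<Suc N. s ^ k) = (s ^ Suc N - 1) / (s - 1)"
      using s1 by (subst geometric_sum) auto
    also have "s * ((s ^ Suc N - 1) / (s - 1)) \<le> s * (s ^ Suc N / (s - 1))"
      using s1 by (intro mult_left_mono divide_right_mono) auto
    also have "\<dots> = s\<^sup>2 / (s - 1) * (r ^ N * p ^ N)"
      by (simp add: s_def power2_eq_square power_mult_distrib)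
    also have "\<dots> \<le> s\<^sup>2 / (s - 1) * (t * p ^ N)"
      using s1 p N by (intro mult_left_mono mult_right_mono) auto
    finally show ?thesis
      using staircase_top[OF r N, of p] by (simp add: s_def)
  qed
  {
    case 0
    show ?case
    proof (cases "1 < t")
      case True
      then show ?thesis using top[of 0] by simp
    next
      case False
      then show ?thesis using s t staircase_ge_1[OF p, of r 0 t] by simp
    qed
  next
    case (Suc N)
    show ?case
    proof (cases "r ^ Suc N < t")
      case True
      then show ?thesis by (rule top)
    next
      case False
      then show ?thesis using Suc by (simp add: staircase_def)
    qed
  }
qed

section \<open>Tail domination implies higher integrability\<close>

text \<open>
  The ratio \<open>p > 1\<close> of consecutive heights. It is the choice that makes the constant in
  \<open>absorption_constant\<close> at most \<open>1 / 2\<close>: with \<open>r = 1 / \<beta>\<close>, it says \<open>p - 1 = (r - 1) / (4 C r\<^sup>2)\<close>.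
\<close>

definition step_ratio :: "real \<Rightarrow> real \<Rightarrow> real" where
  "step_ratio \<beta> C = 1 + \<beta> * (1 - \<beta>) / (4 * C)"

text \<open>The \<open>\<epsilon>\<close> with \<open>r\<^sup>\<epsilon> = p\<close>, by which the exponent of integrability improves.\<close>

definition gain_exponent :: "real \<Rightarrow> real \<Rightarrow> real" where
  "gain_exponent \<beta> C = log (1 / \<beta>) (step_ratio \<beta> C)"

lemma step_ratio_bounds:
  assumes "0 < \<beta>" "\<beta> < 1" "1 < C"
  shows "1 < step_ratio \<beta> C" "step_ratio \<beta> C \<le> 2"
proof -
  show "1 < step_ratio \<beta> C" using assms by (simp add: step_ratio_def)
  have "\<beta> * (1 - \<beta>) \<le> 1 * 1" using assms by (intro mult_mono) auto
  then show "step_ratio \<beta> C \<le> 2" using assms by (simp add: step_ratio_def)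
qed

lemma gain_exponent_pos:
  assumes "0 < \<beta>" "\<beta> < 1" "1 < C"
  shows "0 < gain_exponent \<beta> C" "(1 / \<beta>) powr gain_exponent \<beta> C = step_ratio \<beta> C"
  using assms step_ratio_bounds[OF assms] by (auto simp: gain_exponent_def)

text \<open>
  The factor in front of \<open>X\<close> in the absorption step. It is of order \<open>p - 1\<close>, because
  \<open>p * r - 1 \<ge> r - 1\<close> stays away from zero; the bound \<open>p \<le> 2\<close> disposes of the remaining power of \<open>p\<close>.
\<close>

lemma absorption_constant:
  assumes "0 < \<beta>" "\<beta> < 1" "1 < C"
  defines "p \<equiv> step_ratio \<beta> C"
  defines "r \<equiv> 1 / \<beta>"
  shows "C * (1 - 1 / p) * ((p * r)\<^sup>2 / (p * r - 1)) \<le> 1 / 2"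
proof -
  have p: "1 < p" "p \<le> 2" unfolding p_def using step_ratio_bounds assms by auto
  have r: "1 < r" using assms by simp
  have pr: "r \<le> p * r" using p r by simp
  have "(1 - 1 / p) * (p * r)\<^sup>2 = (p - 1) * (p * r\<^sup>2)"
    using p by (simp add: power2_eq_square field_simps)
  then have "C * (1 - 1 / p) * ((p * r)\<^sup>2 / (p * r - 1)) = C * (p - 1) * (p * r\<^sup>2 / (p * r - 1))"
    by (simp add: mult.assoc)
  also have "\<dots> \<le> C * (p - 1) * (2 * r\<^sup>2 / (r - 1))"
    using p r pr assms by (intro mult_left_mono frac_le mult_right_mono) auto
  also have "p - 1 = (r - 1) / (4 * C * r\<^sup>2)"
    using assms by (simp add: p_def r_def step_ratio_def power2_eq_square field_simps)
  also have "C * ((r - 1) / (4 * C * r\<^sup>2)) * (2 * r\<^sup>2 / (r - 1)) = 1 / 2"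
    using r assms(3) by (simp add: field_simps)
  finally show ?thesis .
qed

text \<open>
  The self-improvement argument for an arbitrary finite measure. The truncation in the step function
  makes \<open>X\<close> finite, so that half of it can be subtracted from both sides; since the resulting bound
  does not depend on the truncation, monotone convergence removes it.
\<close>

lemma higher_integrability_from_tails:
  fixes v :: "'a \<Rightarrow> real" and \<beta> C :: real
  assumes fin: "finite_measure N" and v: "integrable N v" and nn: "AE x in N. 0 \<le> v x"
    and b: "0 < \<beta>" "\<beta> < 1" "1 < C"
    and tail: "\<And>l. 1 < l \<Longrightarrow> (\<integral>x. of_bool (l < v x) * v x \<partial>N)
      \<le> C * l * measure N {x \<in> space N. \<beta> * l < v x}"
  shows "(\<integral>\<^sup>+x. ennreal (v x powr (1 + gain_exponent \<beta> C)) \<partial>N)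
    \<le> ennreal (2 * step_ratio \<beta> C * (\<integral>x. v x \<partial>N))"
proof -
  interpret finite_measure N by fact
  define p where "p = step_ratio \<beta> C"
  define r where "r = 1 / \<beta>"
  define e where "e = gain_exponent \<beta> C"
  let ?K = "(p * r)\<^sup>2 / (p * r - 1)"
  have p: "1 < p" and r: "1 < r"
    using b step_ratio_bounds[OF b] by (auto simp: p_def r_def)
  have [measurable]: "v \<in> borel_measurable N" using v by auto
  have tail_int: "integrable N (\<lambda>x. of_bool (l < v x) * v x)" for l
    using v by (rule Bochner_Integration.integrable_bound)
      (auto simp: of_bool_def)
  have level_int: "(\<integral>x. of_bool (r ^ k < v x) \<partial>N) = measure N {x \<in> space N. r ^ k < v x}"
    "integrable N (\<lambda>x. of_bool (r ^ k < v x) :: real)" for k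
  proof -
    have eq: "of_bool (r ^ k < v x) = (indicator {x \<in> space N. r ^ k < v x} x :: real)"
      if "x \<in> space N" for x
      using that by (simp add: indicator_def)
    show "(\<integral>x. of_bool (r ^ k < v x) \<partial>N) = measure N {x \<in> space N. r ^ k < v x}"
      by (subst Bochner_Integration.integral_cong[OF refl eq]) auto
    show "integrable N (\<lambda>x. of_bool (r ^ k < v x) :: real)"
      by (rule integrable_const_bound[where B = 1]) auto
  qed
  have stair_int: "integrable N (\<lambda>x. v x * staircase p r n (v x))" for n
  proof (rule Bochner_Integration.integrable_bound)
    show "integrable N (\<lambda>x. v x * p ^ n)" using v by simp
    have "norm (v x * staircase p r n (v x)) \<le> norm (v x * p ^ n)" for x
      using p staircase_ge_1[OF p, of r n "v x"] staircase_le[OF p, of r n "v x"]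
      unfolding norm_mult by (intro mult_left_mono) auto
    then show "AE x in N. norm (v x * staircase p r n (v x)) \<le> norm (v x * p ^ n)" by simp
  qed measurable
  have bound: "(\<integral>x. v x * staircase p r n (v x) \<partial>N) \<le> 2 * (\<integral>x. v x \<partial>N)" for n
  proof -
    let ?X = "\<integral>x. v x * staircase p r n (v x) \<partial>N"
    have "?X = (\<integral>x. v x + (\<Sum>k<n. (p ^ Suc k - p ^ k) * (of_bool (r ^ Suc k < v x) * v x)) \<partial>N)"
      by (intro Bochner_Integration.integral_cong)
        (auto simp: staircase_def algebra_simps sum_distrib_left)
    also have "\<dots> = (\<integral>x. v x \<partial>N)
        + (\<Sum>k<n. (p ^ Suc k - p ^ k) * (\<integral>x. of_bool (r ^ Suc k < v x) * v x \<partial>N))"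
      using v tail_int by (subst Bochner_Integration.integral_add) auto
    also have "(\<Sum>k<n. (p ^ Suc k - p ^ k) * (\<integral>x. of_bool (r ^ Suc k < v x) * v x \<partial>N))
        \<le> (\<Sum>k<n. (p ^ Suc k - p ^ k) * (C * r ^ Suc k * measure N {x \<in> space N. r ^ k < v x}))"
    proof (intro sum_mono mult_left_mono)
      fix k
      \<comment> \<open>The levels grow by the factor \<open>1 / \<beta>\<close>, so the tail at one level is controlled by the previous one.\<close>
      have "\<beta> * r ^ Suc k = r ^ k" using b by (simp add: r_def)
      moreover have "1 < r ^ Suc k" using r by (rule one_less_power) simp
      ultimately show "(\<integral>x. of_bool (r ^ Suc k < v x) * v x \<partial>N)
          \<le> C * r ^ Suc k * measure N {x \<in> space N. r ^ k < v x}"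
        using tail[of "r ^ Suc k"] by (simp only:)
    qed (use p in auto)
    also have "\<dots> = C * (1 - 1 / p)
        * (\<Sum>k<n. (p * r) ^ Suc k * measure N {x \<in> space N. r ^ k < v x})"
      unfolding sum_distrib_left
      using p by (intro sum.cong) (auto simp: field_simps power_mult_distrib)
    also have "\<dots> \<le> C * (1 - 1 / p)
        * (\<Sum>k\<le>n. (p * r) ^ Suc k * measure N {x \<in> space N. r ^ k < v x})"
      using p r b by (intro mult_left_mono sum_mono2) auto
    also have "(\<Sum>k\<le>n. (p * r) ^ Suc k * measure N {x \<in> space N. r ^ k < v x})
        = (\<integral>x. (\<Sum>k\<le>n. (p * r) ^ Suc k * of_bool (r ^ k < v x)) \<partial>N)"
      using level_int by (simp del: sum_of_bool_mult_eq sum_mult_of_bool_eq)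
    also have "\<dots> \<le> (\<integral>x. ?K * (v x * staircase p r n (v x)) \<partial>N)"
    proof (rule integral_mono_AE)
      show "integrable N (\<lambda>x. \<Sum>k\<le>n. (p * r) ^ Suc k * of_bool (r ^ k < v x))"
        by (intro Bochner_Integration.integrable_sum integrable_mult_right level_int)
      show "AE x in N. (\<Sum>k\<le>n. (p * r) ^ Suc k * of_bool (r ^ k < v x))
          \<le> ?K * (v x * staircase p r n (v x))"
        using nn by eventually_elim (rule levels_le_staircase[OF p r])
    qed (use stair_int in simp)
    also have "\<dots> = ?K * ?X" by simp
    finally have "?X \<le> (\<integral>x. v x \<partial>N) + C * (1 - 1 / p) * (?K * ?X)"
      using p b by simp
    also have "C * (1 - 1 / p) * (?K * ?X) \<le> 1 / 2 * ?X"
    proof -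
      have "0 \<le> ?X"
        using nn staircase_ge_1[OF p] by (intro integral_nonneg_AE) (auto elim!: eventually_mono
          intro!: mult_nonneg_nonneg intro: order_trans[OF zero_le_one])
      then show ?thesis
        using mult_right_mono[OF absorption_constant[OF b]]
        unfolding p_def r_def by (simp only: mult.assoc)
    qed
    finally show ?thesis by simp
  qed
  have "(\<integral>\<^sup>+x. ennreal (v x powr (1 + e)) \<partial>N)
      \<le> (\<integral>\<^sup>+x. (SUP n. ennreal (p * (v x * staircase p r n (v x)))) \<partial>N)"
  proof (rule nn_integral_mono_AE)
    show "AE x in N. ennreal (v x powr (1 + e)) \<le> (SUP n. ennreal (p * (v x * staircase p r n (v x))))"
      using nn
    proof eventually_elim
      case (elim x)
      show ?case
      proof (cases "v x = 0")
        case False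
        then have pos: "0 < v x" using elim by simp
        obtain n where n: "v x powr e \<le> p * staircase p r n (v x)"
          using powr_le_staircase[OF p r _ pos, of e] gain_exponent_pos(2)[OF b]
          by (auto simp: p_def r_def e_def)
        have "v x powr (1 + e) = v x * v x powr e" using pos by (simp add: powr_add)
        also have "\<dots> \<le> v x * (p * staircase p r n (v x))"
          using n pos by (intro mult_left_mono) auto
        finally have "ennreal (v x powr (1 + e)) \<le> ennreal (p * (v x * staircase p r n (v x)))"
          by (intro ennreal_leI) (simp add: ac_simps)
        then show ?thesis by (rule SUP_upper2[rotated]) simp
      qed simp
    qed
  qed
  also have "\<dots> = (SUP n. \<integral>\<^sup>+x. ennreal (p * (v x * staircase p r n (v x))) \<partial>N)"
  proof (rule nn_integral_monotone_convergence_SUP_AE)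
    show "AE x in N. ennreal (p * (v x * staircase p r n (v x)))
        \<le> ennreal (p * (v x * staircase p r (Suc n) (v x)))" for n
      using nn by eventually_elim
        (use p in \<open>auto intro!: ennreal_leI mult_left_mono staircase_mono\<close>)
  qed measurable
  also have "\<dots> \<le> ennreal (2 * p * (\<integral>x. v x \<partial>N))"
  proof (rule SUP_least)
    fix n
    have "(\<integral>\<^sup>+x. ennreal (p * (v x * staircase p r n (v x))) \<partial>N)
        = ennreal (\<integral>x. p * (v x * staircase p r n (v x)) \<partial>N)"
    proof (rule nn_integral_eq_integral)
      show "AE x in N. 0 \<le> p * (v x * staircase p r n (v x))"
        using nn by eventually_elim
          (use p order_trans[OF zero_le_one staircase_ge_1[OF p]] in auto)
    qed (use stair_int in simp)
    also have "\<dots> \<le> ennreal (2 * p * (\<integral>x. v x \<partial>N))"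
      using bound[of n] p by (intro ennreal_leI) (simp add: ac_simps)
    finally show "(\<integral>\<^sup>+x. ennreal (p * (v x * staircase p r n (v x))) \<partial>N)
      \<le> ennreal (2 * p * (\<integral>x. v x \<partial>N))" .
  qed
  finally show ?thesis by (simp only: p_def e_def)
qed

section \<open>Normalising a weight\<close>

context finite_measure_subalgebra
begin

text \<open>
  A conditional expectation is bounded by \<open>c\<close> if its integrals over the sets of the subalgebra are. The
  test set is the one where it exceeds \<open>c\<close>: the excess over \<open>c\<close> has integral zero there, because
  \<open>c * emeasure M A\<close> is finite and may be cancelled.
\<close>

lemma nn_cond_exp_le_constI:
  assumes [measurable]: "f \<in> borel_measurable M"
    and le: "\<And>A. A \<in> sets F \<Longrightarrow> (\<integral>\<^sup>+x. indicator A x * f x \<partial>M) \<le> ennreal c * emeasure M A"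
  shows "AE x in M. nn_cond_exp M F f x \<le> ennreal c"
proof -
  let ?e = "nn_cond_exp M F f"
  define A where "A = {x \<in> space F. ennreal c < ?e x}"
  have A: "A \<in> sets F" unfolding A_def by measurable
  then have [measurable]: "A \<in> sets M" using subalg by (auto simp: subalgebra_def)
  have split: "indicator A x * ?e x = indicator A x * ennreal c + indicator A x * (?e x - ennreal c)" for x
    by (cases "x \<in> A") (auto simp: A_def add.commute[of "ennreal c"] diff_add_cancel_ennreal less_imp_le)
  let ?I = "\<integral>\<^sup>+x. indicator A x * (?e x - ennreal c) \<partial>M"
  have "ennreal c * emeasure M A + ?I = (\<integral>\<^sup>+x. indicator A x * ?e x \<partial>M)"
    unfolding split by (subst nn_integral_add) (auto simp: nn_integral_multc mult.commute[of "emeasure M A"])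
  also have "\<dots> = (\<integral>\<^sup>+x. indicator A x * f x \<partial>M)"
    using A by (intro nn_cond_exp_intg) auto
  also have "\<dots> \<le> ennreal c * emeasure M A + 0" using le[OF A] by simp
  finally have "?I \<le> 0"
    by (subst (asm) ennreal_add_left_cancel_le) (auto simp: ennreal_mult_eq_top_iff)
  then have "?I = 0" by simp
  then have "AE x in M. indicator A x * (?e x - ennreal c) = 0"
    by (subst (asm) nn_integral_0_iff_AE) auto
  then show ?thesis
    using AE_space
  proof eventually_elim
    case (elim x)
    show ?case
    proof (rule ccontr)
      assume "\<not> ?thesis"
      then have "ennreal c < ?e x" by simp
      moreover from this have "x \<in> A"
        using elim subalg by (auto simp: A_def subalgebra_def)
      ultimately show False using elim by (auto simp: diff_eq_0_iff_ennreal less_top)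
    qed
  qed
qed

end

locale weighted_subalgebra = prob_space M + finite_measure_subalgebra M G
  for M G :: "'a measure" +
  fixes w :: "'a \<Rightarrow> real"
  assumes weight: "weight M w"
begin

abbreviation wG :: "'a \<Rightarrow> real" where "wG \<equiv> real_cond_exp M G w"

abbreviation v :: "'a \<Rightarrow> real" where "v \<equiv> \<lambda>x. w x / wG x"

lemma w_measurable [measurable]: "w \<in> borel_measurable M"
  and w_integrable: "integrable M w"
  and w_pos: "AE x in M. 0 < w x"
  using weight by (auto simp: weight_def)

lemma nn_cond_exp_w: "AE x in M. nn_cond_exp M G (\<lambda>x. ennreal (w x)) x = ennreal (wG x)"
proof -
  have "AE x in M. nn_cond_exp M G (\<lambda>x. ennreal (- w x)) x = nn_cond_exp M G (\<lambda>x. 0) x"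
    using w_pos by (intro nn_cond_exp_cong) (auto elim!: eventually_mono simp: ennreal_neg)
  moreover have "AE x in M. 0 = nn_cond_exp M G (\<lambda>x. 0) x"
    by (rule nn_cond_exp_F_meas) simp
  moreover have "AE x in M. nn_cond_exp M G (\<lambda>x. ennreal (w x)) x \<noteq> \<infinity>"
  proof (rule nn_integral_noteq_infinite)
    have "(\<integral>\<^sup>+x. 1 * nn_cond_exp M G (\<lambda>x. ennreal (w x)) x \<partial>M) = (\<integral>\<^sup>+x. 1 * ennreal (w x) \<partial>M)"
      by (rule nn_cond_exp_intg) auto
    then show "(\<integral>\<^sup>+x. nn_cond_exp M G (\<lambda>x. ennreal (w x)) x \<partial>M) \<noteq> \<infinity>"
      using w_integrable w_pos
      by (subst (asm) (2) nn_integral_cong_AE[where v = "\<lambda>x. ennreal (norm (w x))"])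
        (auto simp: integrable_iff_bounded less_top elim: eventually_mono)
  qed simp
  ultimately show ?thesis
    by eventually_elim (auto simp: real_cond_exp_def less_top)
qed

lemma wG_pos: "AE x in M. 0 < wG x"
  using real_cond_exp_gr_c[OF w_integrable w_pos] by simp

lemma v_pos: "AE x in M. 0 < v x"
  using w_pos wG_pos by eventually_elim simp

text \<open>Dividing by \<open>wG\<close>, which is \<open>G\<close>-measurable, can be done inside the conditional expectation.\<close>

lemma weighted_cond_exp_eq_v:
  assumes [measurable]: "f \<in> borel_measurable M"
  shows "AE x in M. weighted_cond_exp M w G f x = nn_cond_exp M G (\<lambda>x. f x * ennreal (v x)) x"
proof -
  have "AE x in M. weighted_cond_exp M w G f x
      = nn_cond_exp M G (\<lambda>x. f x * ennreal (w x)) x / nn_cond_exp M G (\<lambda>x. ennreal (w x)) x"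
    by (rule weighted_cond_exp_eq[OF prob_space_axioms subalg weight]) measurable
  moreover have "AE x in M. inverse (ennreal (wG x)) * nn_cond_exp M G (\<lambda>x. f x * ennreal (w x)) x
      = nn_cond_exp M G (\<lambda>x. inverse (ennreal (wG x)) * (f x * ennreal (w x))) x"
    by (rule nn_cond_exp_prod) auto
  moreover have "AE x in M. nn_cond_exp M G (\<lambda>x. inverse (ennreal (wG x)) * (f x * ennreal (w x))) x
      = nn_cond_exp M G (\<lambda>x. f x * ennreal (v x)) x"
  proof (rule nn_cond_exp_cong)
    show "AE x in M. inverse (ennreal (wG x)) * (f x * ennreal (w x)) = f x * ennreal (v x)"
      using w_pos wG_pos by eventually_elim
        (simp add: inverse_ennreal divide_ennreal[symmetric] divide_ennreal_def ac_simps)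
  qed measurable
  ultimately show ?thesis
    using nn_cond_exp_w by eventually_elim (simp add: divide_ennreal_def mult.commute)
qed

lemma nn_cond_exp_v: "AE x in M. nn_cond_exp M G (\<lambda>x. ennreal (v x)) x = 1"
proof -
  have "AE x in M. weighted_cond_exp M w G (\<lambda>_. 1) x
      = nn_cond_exp M G (\<lambda>x. 1 * ennreal (w x)) x / nn_cond_exp M G (\<lambda>x. ennreal (w x)) x"
    by (rule weighted_cond_exp_eq[OF prob_space_axioms subalg weight]) measurable
  moreover have "AE x in M. weighted_cond_exp M w G (\<lambda>_. 1) x = nn_cond_exp M G (\<lambda>x. 1 * ennreal (v x)) x"
    by (rule weighted_cond_exp_eq_v) measurable
  ultimately show ?thesis
    using nn_cond_exp_w wG_pos by eventually_elim (simp add: ennreal_divide_self)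
qed

section \<open>From tails to the reverse Hoelder inequality\<close>

text \<open>
  To bound \<open>E(v powr q | G)\<close> it suffices to integrate over sets \<open>A\<close> of \<open>G\<close>. On \<open>A\<close> the conditional
  tail hypothesis becomes the unconditional one for the measure restricted to \<open>A\<close>, under which \<open>v\<close>
  has integral \<open>emeasure M A\<close> because \<open>E(v | G) = 1\<close>.
\<close>

lemma tails_imp_moment_v:
  assumes b: "0 < \<beta>" "\<beta> < 1" "1 < C"
    and tails: "\<And>l. 1 < l \<Longrightarrow> AE x in M.
      weighted_cond_exp M w G (indicator {y \<in> space M. v y > l}) x
        \<le> ennreal (C * l) * nn_cond_exp M G (indicator {y \<in> space M. v y > \<beta> * l}) x"
  shows "AE x in M. nn_cond_exp M G (\<lambda>y. ennreal (v y powr (1 + gain_exponent \<beta> C))) x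
    \<le> ennreal (2 * step_ratio \<beta> C)"
proof (rule nn_cond_exp_le_constI)
  fix A assume A: "A \<in> sets G"
  then have [measurable]: "A \<in> sets M" using subalg by (auto simp: subalgebra_def)
  define N where "N = density M (indicator A)"
  have [measurable_cong]: "sets N = sets M" and space_N: "space N = space M"
    by (simp_all add: N_def)
  have nn_N: "(\<integral>\<^sup>+x. f x \<partial>N) = (\<integral>\<^sup>+x. indicator A x * f x \<partial>M)"
    if "f \<in> borel_measurable M" for f :: "'a \<Rightarrow> ennreal"
    using that by (simp add: N_def nn_integral_density)
  have emeasure_N: "emeasure N B = (\<integral>\<^sup>+x. indicator A x * indicator B x \<partial>M)" if "B \<in> sets M" for B
    using that by (simp add: N_def emeasure_density)
  have fin: "finite_measure N"
  proof (rule finite_measureI)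
    have "emeasure N (space N) \<le> emeasure M A"
      by (simp add: space_N emeasure_N flip: indicator_inter_arith cong: nn_integral_cong)
    then show "emeasure N (space N) \<noteq> \<infinity>"
      using emeasure_finite[of A] by (auto simp: top_unique)
  qed
  interpret N: finite_measure N by fact
  have pos: "AE x in N. 0 < v x"
    unfolding N_def using v_pos by (subst AE_density) (auto elim: eventually_mono)
  have int_1: "(\<integral>\<^sup>+x. ennreal (v x) \<partial>N) = emeasure M A"
  proof -
    have "(\<integral>\<^sup>+x. ennreal (v x) \<partial>N) = (\<integral>\<^sup>+x. indicator A x * nn_cond_exp M G (\<lambda>x. ennreal (v x)) x \<partial>M)"
      using A by (simp add: nn_N nn_cond_exp_intg)
    also have "\<dots> = (\<integral>\<^sup>+x. indicator A x \<partial>M)"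
      using nn_cond_exp_v by (intro nn_integral_cong_AE) (auto elim!: eventually_mono)
    finally show ?thesis by simp
  qed
  have v: "integrable N v"
    using pos int_1 emeasure_eq_measure[of A]
    by (intro integrableI_nonneg) (auto elim!: eventually_mono simp: less_top)
  have nn_v: "(\<integral>\<^sup>+x. ennreal (v x) \<partial>N) = ennreal (\<integral>x. v x \<partial>N)"
    using v pos by (intro nn_integral_eq_integral) (auto elim!: eventually_mono)
  have "(\<integral>\<^sup>+x. ennreal (v x powr (1 + gain_exponent \<beta> C)) \<partial>N)
      \<le> ennreal (2 * step_ratio \<beta> C * (\<integral>x. v x \<partial>N))"
  proof (rule higher_integrability_from_tails[OF fin v _ b])
    show "AE x in N. 0 \<le> v x" using pos by eventually_elim simp
    fix l :: real assume l: "1 < l"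
    define T where "T k = {y \<in> space M. v y > k}" for k
    have [measurable]: "T k \<in> sets M" for k unfolding T_def by measurable
    have "ennreal (\<integral>x. of_bool (l < v x) * v x \<partial>N) = (\<integral>\<^sup>+x. ennreal (of_bool (l < v x) * v x) \<partial>N)"
    proof (rule nn_integral_eq_integral[symmetric])
      show "integrable N (\<lambda>x. of_bool (l < v x) * v x)"
        using v by (rule Bochner_Integration.integrable_bound) (auto simp: of_bool_def)
      show "AE x in N. 0 \<le> of_bool (l < v x) * v x" using pos by eventually_elim simp
    qed
    also have "\<dots> = (\<integral>\<^sup>+x. indicator A x * (indicator (T l) x * ennreal (v x)) \<partial>M)"
      by (subst nn_N) (auto intro!: nn_integral_cong simp: T_def indicator_def)
    also have "\<dots> = (\<integral>\<^sup>+x. indicator A x * nn_cond_exp M G (\<lambda>x. indicator (T l) x * ennreal (v x)) x \<partial>M)"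
      using A by (intro nn_cond_exp_intg[symmetric]) auto
    also have "\<dots> \<le> (\<integral>\<^sup>+x. indicator A x * (ennreal (C * l) * nn_cond_exp M G (indicator (T (\<beta> * l))) x) \<partial>M)"
    proof (rule nn_integral_mono_AE)
      have "AE x in M. weighted_cond_exp M w G (indicator (T l)) x
          = nn_cond_exp M G (\<lambda>x. indicator (T l) x * ennreal (v x)) x"
        by (rule weighted_cond_exp_eq_v) measurable
      then show "AE x in M. indicator A x * nn_cond_exp M G (\<lambda>x. indicator (T l) x * ennreal (v x)) x
          \<le> indicator A x * (ennreal (C * l) * nn_cond_exp M G (indicator (T (\<beta> * l))) x)"
        using tails[OF l, folded T_def] by eventually_elim (auto intro!: mult_left_mono)
    qed
    also have "\<dots> = ennreal (C * l) * (\<integral>\<^sup>+x. indicator A x * nn_cond_exp M G (indicator (T (\<beta> * l))) x \<partial>M)"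
      by (subst nn_integral_cmult[symmetric]) (auto simp: ac_simps)
    also have "(\<integral>\<^sup>+x. indicator A x * nn_cond_exp M G (indicator (T (\<beta> * l))) x \<partial>M)
        = (\<integral>\<^sup>+x. indicator A x * indicator (T (\<beta> * l)) x \<partial>M)"
      using A by (intro nn_cond_exp_intg) auto
    also have "\<dots> = ennreal (measure N (T (\<beta> * l)))"
      by (simp add: emeasure_N flip: N.emeasure_eq_measure)
    also have "ennreal (C * l) * \<dots> = ennreal (C * l * measure N (T (\<beta> * l)))"
      using b l by (intro ennreal_mult[symmetric]) auto
    finally show "(\<integral>x. of_bool (l < v x) * v x \<partial>N) \<le> C * l * measure N {x \<in> space N. \<beta> * l < v x}"
      using b l by (subst (asm) ennreal_le_iff) (auto simp: T_def space_N)
  qed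
  also have "\<dots> = ennreal (2 * step_ratio \<beta> C) * emeasure M A"
    using step_ratio_bounds[OF b] pos
    by (subst ennreal_mult) (auto intro!: integral_nonneg_AE elim!: eventually_mono simp: int_1 simp flip: nn_v)
  finally show "(\<integral>\<^sup>+x. indicator A x * ennreal (v x powr (1 + gain_exponent \<beta> C)) \<partial>M)
      \<le> ennreal (2 * step_ratio \<beta> C) * emeasure M A"
    by (simp add: nn_N)
qed measurable

text \<open>The bound for \<open>v\<close> scales to \<open>w = wG * v\<close>, since powers of \<open>wG\<close> are \<open>G\<close>-measurable.\<close>

lemma tails_imp_reverse_Hoelder:
  assumes b: "0 < \<beta>" "\<beta> < 1" "1 < C"
    and tails: "\<And>l. 1 < l \<Longrightarrow> AE x in M.
      weighted_cond_exp M w G (indicator {y \<in> space M. v y > l}) x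
        \<le> ennreal (C * l) * nn_cond_exp M G (indicator {y \<in> space M. v y > \<beta> * l}) x"
  defines "q \<equiv> 1 + gain_exponent \<beta> C"
  shows "AE x in M. nn_cond_exp M G (\<lambda>y. ennreal (w y powr q)) x
    \<le> ennreal (2 * step_ratio \<beta> C * wG x powr q)"
proof -
  have "AE x in M. nn_cond_exp M G (\<lambda>y. ennreal (w y powr q)) x
      = nn_cond_exp M G (\<lambda>y. ennreal (wG y powr q) * ennreal (v y powr q)) x"
  proof (rule nn_cond_exp_cong)
    show "AE x in M. ennreal (w x powr q) = ennreal (wG x powr q) * ennreal (v x powr q)"
      using w_pos wG_pos by eventually_elim (simp add: powr_divide flip: ennreal_mult)
  qed measurable
  moreover have "AE x in M. ennreal (wG x powr q) * nn_cond_exp M G (\<lambda>y. ennreal (v y powr q)) x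
      = nn_cond_exp M G (\<lambda>y. ennreal (wG y powr q) * ennreal (v y powr q)) x"
    by (rule nn_cond_exp_prod) auto
  moreover have "AE x in M. nn_cond_exp M G (\<lambda>y. ennreal (v y powr q)) x \<le> ennreal (2 * step_ratio \<beta> C)"
    unfolding q_def by (rule tails_imp_moment_v[OF b tails])
  ultimately show ?thesis
  proof eventually_elim
    case (elim x)
    have "ennreal (wG x powr q) * nn_cond_exp M G (\<lambda>y. ennreal (v y powr q)) x
        \<le> ennreal (wG x powr q) * ennreal (2 * step_ratio \<beta> C)"
      using elim by (intro mult_left_mono) auto
    also have "\<dots> = ennreal (2 * step_ratio \<beta> C * wG x powr q)"
      using step_ratio_bounds[OF b] by (simp add: mult.commute flip: ennreal_mult)
    finally show ?case using elim by simp
  qed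
qed

section \<open>From the reverse Hoelder inequality to small sets\<close>

text \<open>
  A logarithm is dominated by any positive power: \<open>ln t \<le> t powr (q - 1) / (q - 1)\<close> for \<open>t \<ge> 1\<close>.
  Multiplied by \<open>t = v\<close>, this has the power \<open>v powr q = w powr q / wG powr q\<close> on the right.
\<close>

lemma reverse_Hoelder_imp_log:
  assumes q: "1 < q" and C: "1 < C"
    and rh: "AE x in M. nn_cond_exp M G (\<lambda>y. ennreal (w y powr q)) x \<le> ennreal (C * wG x powr q)"
  shows "AE x in M. weighted_cond_exp M w G (\<lambda>y. ennreal (max (ln (v y)) 0)) x \<le> ennreal (C / (q - 1))"
proof -
  let ?c = "\<lambda>x. ennreal (1 / ((q - 1) * wG x powr q))"
  have "AE x in M. weighted_cond_exp M w G (\<lambda>y. ennreal (max (ln (v y)) 0)) x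
      = nn_cond_exp M G (\<lambda>y. ennreal (max (ln (v y)) 0) * ennreal (v y)) x"
    by (rule weighted_cond_exp_eq_v) measurable
  moreover have "AE x in M. nn_cond_exp M G (\<lambda>y. ennreal (max (ln (v y)) 0) * ennreal (v y)) x
      \<le> nn_cond_exp M G (\<lambda>y. ?c y * ennreal (w y powr q)) x"
  proof (rule nn_cond_exp_mono)
    show "AE x in M. ennreal (max (ln (v x)) 0) * ennreal (v x) \<le> ?c x * ennreal (w x powr q)"
      using w_pos wG_pos
    proof eventually_elim
      case (elim x)
      define t where "t = v x"
      have t: "0 < t" using elim by (simp add: t_def)
      have "max (ln t) 0 \<le> t powr (q - 1) / (q - 1)"
      proof (cases "1 \<le> t")
        case True
        then show ?thesis using ln_powr_bound[of t "q - 1"] q by simp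
      next
        case False
        then show ?thesis using t q by (simp add: max_def)
      qed
      then have "max (ln t) 0 * t \<le> t powr (q - 1) / (q - 1) * t"
        using t by (intro mult_right_mono) auto
      also have "\<dots> = t powr q / (q - 1)"
        using t by (simp add: powr_diff)
      also have "\<dots> = 1 / ((q - 1) * wG x powr q) * w x powr q"
        using elim by (simp add: t_def powr_divide)
      finally have "ennreal (max (ln t) 0 * t) \<le> ennreal (1 / ((q - 1) * wG x powr q) * w x powr q)"
        by (rule ennreal_leI)
      then show ?case
        unfolding t_def[symmetric] using t q elim by (subst (asm) (1 2) ennreal_mult) auto
    qed
  qed measurable
  moreover have "AE x in M. ?c x * nn_cond_exp M G (\<lambda>y. ennreal (w y powr q)) x
      = nn_cond_exp M G (\<lambda>y. ?c y * ennreal (w y powr q)) x"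
    by (rule nn_cond_exp_prod) auto
  ultimately show ?thesis
    using rh wG_pos
  proof eventually_elim
    case (elim x)
    have "?c x * nn_cond_exp M G (\<lambda>y. ennreal (w y powr q)) x \<le> ?c x * ennreal (C * wG x powr q)"
      using elim by (intro mult_left_mono) auto
    also have "\<dots> = ennreal (C / (q - 1))"
      using elim q C by (simp flip: ennreal_mult)
    finally show ?case using elim by simp
  qed
qed

text \<open>
  The mass that \<open>v\<close> puts on \<open>A\<close> comes from two parts. Where \<open>v \<le> exp (4 * C)\<close> it is at most
  \<open>exp (4 * C)\<close> times the conditional probability of \<open>A\<close>; where \<open>v > exp (4 * C)\<close> the logarithm of \<open>v\<close>
  exceeds \<open>4 * C\<close>, and the logarithmic bound leaves at most \<open>C / (4 * C)\<close>. The level and the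
  smallness of \<open>A\<close> are chosen so that each part is at most \<open>1 / 4\<close>.
\<close>

lemma log_imp_small_sets:
  assumes C: "1 < C"
    and lg: "AE x in M. weighted_cond_exp M w G (\<lambda>y. ennreal (max (ln (v y)) 0)) x \<le> ennreal C"
    and A [measurable]: "A \<in> sets M"
    and small: "AE x in M. nn_cond_exp M G (indicator A) x \<le> ennreal (exp (- 4 * C) / 4)"
  shows "AE x in M. weighted_cond_exp M w G (indicator A) x \<le> ennreal (1 / 2)"
proof -
  let ?K = "ennreal (exp (4 * C))" and ?d = "ennreal (1 / (4 * C))"
  let ?L = "\<lambda>y. ennreal (max (ln (v y)) 0) * ennreal (v y)"
  have "AE x in M. weighted_cond_exp M w G (\<lambda>y. ennreal (max (ln (v y)) 0)) x = nn_cond_exp M G ?L x"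
    by (rule weighted_cond_exp_eq_v) measurable
  moreover have "AE x in M. weighted_cond_exp M w G (indicator A) x
      = nn_cond_exp M G (\<lambda>y. indicator A y * ennreal (v y)) x"
    by (rule weighted_cond_exp_eq_v) measurable
  moreover have "AE x in M. nn_cond_exp M G (\<lambda>y. indicator A y * ennreal (v y)) x
      \<le> nn_cond_exp M G (\<lambda>y. ?K * indicator A y + ?d * ?L y) x"
  proof (rule nn_cond_exp_mono)
    show "AE x in M. indicator A x * ennreal (v x) \<le> ?K * indicator A x + ?d * ?L x"
      using v_pos
    proof eventually_elim
      case (elim x)
      define t where "t = v x"
      have t: "0 < t" using elim by (simp add: t_def)
      show ?case
      proof (cases "t \<le> exp (4 * C)")
        case True
        then have "indicator A x * ennreal t \<le> ?K * indicator A x"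
          by (auto simp: indicator_def ennreal_leI)
        then show ?thesis unfolding t_def by (rule order_trans) simp
      next
        case False
        then have "4 * C < ln t" using t by (metis exp_ln exp_less_cancel_iff not_le)
        then have "1 \<le> 1 / (4 * C) * max (ln t) 0"
          using C by (simp add: field_simps)
        then have "1 * t \<le> 1 / (4 * C) * max (ln t) 0 * t"
          using t by (intro mult_right_mono) auto
        then have "ennreal t \<le> ennreal (1 / (4 * C) * (max (ln t) 0 * t))"
          by (intro ennreal_leI) (simp add: mult.assoc)
        also have "\<dots> = ?d * (ennreal (max (ln t) 0) * ennreal t)"
          using t C by (subst ennreal_mult, simp, simp, subst ennreal_mult) auto
        finally have "ennreal t \<le> ?d * (ennreal (max (ln t) 0) * ennreal t)" .
        moreover have "indicator A x * ennreal t \<le> ennreal t"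
          by (simp add: indicator_def)
        ultimately show ?thesis unfolding t_def
          by (meson add_increasing order_trans zero_le)
      qed
    qed
  qed measurable
  moreover have "AE x in M. nn_cond_exp M G (\<lambda>y. ?K * indicator A y) x + nn_cond_exp M G (\<lambda>y. ?d * ?L y) x
      = nn_cond_exp M G (\<lambda>y. ?K * indicator A y + ?d * ?L y) x"
    by (rule nn_cond_exp_sum) auto
  moreover have "AE x in M. ?K * nn_cond_exp M G (indicator A) x = nn_cond_exp M G (\<lambda>y. ?K * indicator A y) x"
    by (rule nn_cond_exp_prod) auto
  moreover have "AE x in M. ?d * nn_cond_exp M G ?L x = nn_cond_exp M G (\<lambda>y. ?d * ?L y) x"
    by (rule nn_cond_exp_prod) auto
  ultimately show ?thesis
    using lg small
  proof eventually_elim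
    case (elim x)
    have "?K * nn_cond_exp M G (indicator A) x \<le> ?K * ennreal (exp (- 4 * C) / 4)"
      using elim by (intro mult_left_mono) auto
    also have "\<dots> = ennreal (1 / 4)"
      by (simp add: exp_minus field_simps flip: ennreal_mult)
    finally have 1: "?K * nn_cond_exp M G (indicator A) x \<le> ennreal (1 / 4)" .
    have "?d * nn_cond_exp M G ?L x \<le> ?d * ennreal C"
      using elim by (intro mult_left_mono) auto
    also have "\<dots> = ennreal (1 / 4)"
      using C by (simp flip: ennreal_mult)
    finally have 2: "?d * nn_cond_exp M G ?L x \<le> ennreal (1 / 4)" .
    have "weighted_cond_exp M w G (indicator A) x
        \<le> ?K * nn_cond_exp M G (indicator A) x + ?d * nn_cond_exp M G ?L x"
      using elim by simp
    also have "\<dots> \<le> ennreal (1 / 4) + ennreal (1 / 4)"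
      using 1 2 by (rule add_mono)
    also have "\<dots> = ennreal (1 / 2)"
      by (simp flip: ennreal_plus)
    finally show ?case .
  qed
qed

end

section \<open>The chain of implications\<close>

theorem theorem1p6:
  fixes M :: "'a measure" and F :: "nat \<Rightarrow> 'a measure" and w :: "'a \<Rightarrow> real"
  assumes "complete_filtered_prob_space M F"
    and "weight M w"
  shows "(A_infty_lambda M F w \<longrightarrow> (\<exists>q > 1. RH M F q w)) \<and>
         ((\<exists>q > 1. RH M F q w) \<longrightarrow> A_infty_log M F w) \<and>
         (A_infty_log M F w \<longrightarrow> A_infty_M M F w)"
proof -
  interpret complete_filtered_prob_space M F by fact
  have W: "weighted_subalgebra M (F n) w" for n
    using assms(2) sets_F_subset space_F
    by unfold_locales (auto simp: subalgebra_def)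
  show ?thesis
  proof (intro conjI impI)
    assume "A_infty_lambda M F w"
    then obtain \<beta> C where b: "0 < \<beta>" "\<beta> < 1" "1 < C"
      and tails: "\<And>n l. 1 < l \<Longrightarrow> AE x in M.
        weighted_cond_exp M w (F n) (indicator {y \<in> space M. w y / real_cond_exp M (F n) w y > l}) x
          \<le> ennreal (C * l) * nn_cond_exp M (F n)
              (indicator {y \<in> space M. w y / real_cond_exp M (F n) w y > \<beta> * l}) x"
      unfolding A_infty_lambda_def by blast
    let ?q = "1 + gain_exponent \<beta> C" and ?C = "2 * step_ratio \<beta> C"
    have "RH M F ?q w"
      unfolding RH_def
      using step_ratio_bounds[OF b]
      by (intro exI[of _ ?C] conjI allI weighted_subalgebra.tails_imp_reverse_Hoelder[OF W b tails]) auto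
    then show "\<exists>q>1. RH M F q w"
      using gain_exponent_pos[OF b] by (intro exI[of _ ?q]) auto
  next
    assume "\<exists>q>1. RH M F q w"
    then obtain q C where q: "1 < q" and C: "1 < C"
      and rh: "\<And>n. AE x in M. nn_cond_exp M (F n) (\<lambda>y. ennreal (w y powr q)) x
        \<le> ennreal (C * real_cond_exp M (F n) w x powr q)"
      unfolding RH_def by blast
    \<comment> \<open>The maximum with 2 is there because the constant has to exceed 1.\<close>
    have "AE x in M. weighted_cond_exp M w (F n)
        (\<lambda>y. ennreal (max (ln (w y / real_cond_exp M (F n) w y)) 0)) x
        \<le> ennreal (max 2 (C / (q - 1)))" for n
      using weighted_subalgebra.reverse_Hoelder_imp_log[OF W q C rh, of n]
      by eventually_elim (auto elim!: order_trans intro!: ennreal_leI)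
    then show "A_infty_log M F w"
      unfolding A_infty_log_def by (intro exI[of _ "max 2 (C / (q - 1))"]) auto
  next
    assume "A_infty_log M F w"
    then obtain C where C: "1 < C"
      and lg: "\<And>n. AE x in M. weighted_cond_exp M w (F n)
        (\<lambda>y. ennreal (max (ln (w y / real_cond_exp M (F n) w y)) 0)) x \<le> ennreal C"
      unfolding A_infty_log_def by blast
    have "exp (- 4 * C) \<le> 1" using C by simp
    then have "exp (- 4 * C) / 4 < 1" by linarith
    then show "A_infty_M M F w"
      unfolding A_infty_M_def
      using weighted_subalgebra.log_imp_small_sets[OF W C lg]
      by (intro exI[of _ "exp (- 4 * C) / 4"] exI[of _ "1 / 2"]) auto
  qed
qed

end
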